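(* Let $\mathcal E^{j+1}$ and $\mathcal D^{j+1}$ ($j\ge0$) be the discrete energy and dissipation quantities evaluated from the fields used in the ideal SAV update, and assume $\mathcal D^{j+1}\ge0$ and $\mathcal E^{j+1}+C_0>0$. Let the auxiliary variable $R^j$ be updated by $$\frac{R^{j+1}-R^j}{\Delta t_j}=-\frac{R^{j+1}}{\mathcal E^{j+1}+C_0}\,\mathcal D^{j+1}.$$ If $R^j\ge0$, then $$R^{j+1}=\frac{R^j}{1+\Delta t_j\,\mathcal D^{j+1}/(\mathcal E^{j+1}+C_0)}\le R^j.$$ Consequently, the SAV auxiliary sequence is nonincreasing.
   Context: $\mathcal E^j,\mathcal D^j,R^j,C_0$ are real numbers and $\Delta t_j=t_{j+1}-t_j>0$ are time increments between correction instants $t_0<t_1<\cdots$. The sequence is initialized by $R^0=\mathcal E^0+C_0$, where $C_0$ is chosen so that $\mathcal E^j+C_0>0$ at all correction instants $j\ge 0$ (hence $R^0>0$). Only these properties of the quantities are used in the statement. For the PNP system, $\mathcal E^j$ is the value at time $t_j$ of the free energy $\int_\Omega\sum_ic_i\log c_i+\frac{\epsilon_p^2}{2}|\nabla\phi|^2\,d\mathbf x$ and $\mathcal D^j$ that of $\int_\Omega\sum_iD_ic_i|\nabla(\log c_i+z_i\phi)|^2\,d\mathbf x$; for the PNP--Navier--Stokes system one adds $\frac12|\mathbf u|^2$ and $\nu|\nabla\mathbf u|^2$ to the respective integrands. *)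

theory Defs
  imports Complex_Main
begin

text \<open>
  The sequences \<open>E\<close>, \<open>D\<close>, \<open>R\<close>, \<open>t\<close> are indexed by the correction instants; \<open>t j\<close> is the
  \<open>j\<close>-th instant, so the time increment is \<open>t (Suc j) - t j\<close>.
  The update is implicit: \<open>R (Suc j)\<close> occurs on both sides.
\<close>

definition sav_update ::
  "(nat \<Rightarrow> real) \<Rightarrow> (nat \<Rightarrow> real) \<Rightarrow> (nat \<Rightarrow> real) \<Rightarrow> real \<Rightarrow> (nat \<Rightarrow> real) \<Rightarrow> nat \<Rightarrow> bool"
  where "sav_update t E D C\<^sub>0 R j \<longleftrightarrow>
    (R (Suc j) - R j) / (t (Suc j) - t j) = - (R (Suc j) / (E (Suc j) + C\<^sub>0)) * D (Suc j)"

end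

theory Submission imports Defs begin

text \<open>
  The update is linear in the unknown \<open>R (Suc j)\<close>: collecting terms gives
  \<open>R (Suc j) * (1 + a) = R j\<close> with \<open>a = \<Delta>t D / (E + C\<^sub>0) \<ge> 0\<close>. The factor \<open>1 + a\<close> is at
  least \<open>1\<close>, so the equation can be solved, and dividing a nonnegative \<open>R j\<close> by it gives a
  value that is again nonnegative and does not exceed \<open>R j\<close>. Preservation of the sign lets the
  one-step bound be iterated from \<open>R 0 = E 0 + C\<^sub>0 > 0\<close>, which yields monotonicity.
\<close>

lemma sav_update_solved:
  assumes "t (Suc j) - t j > 0" and "D (Suc j) \<ge> 0" and "E (Suc j) + C\<^sub>0 > 0"
    and "sav_update t E D C\<^sub>0 R j"
  shows "R (Suc j) = R j / (1 + (t (Suc j) - t j) * D (Suc j) / (E (Suc j) + C\<^sub>0))"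
proof -
  define h e d where "h = t (Suc j) - t j" and "e = E (Suc j) + C\<^sub>0" and "d = D (Suc j)"
  have pos: "h > 0" "e > 0" "d \<ge> 0"
    using assms by (simp_all add: h_def e_def d_def)
  have "(R (Suc j) - R j) / h = - (R (Suc j) / e) * d"
    using assms(4) by (simp add: sav_update_def h_def e_def d_def)
  then have "R (Suc j) - R j = - (R (Suc j) / e) * d * h"
    using pos(1) by (simp add: divide_eq_eq)
  then have "R (Suc j) * (1 + h * d / e) = R j"
    by (simp add: algebra_simps)
  moreover have "1 + h * d / e > 0"
    using pos by (simp add: add_pos_nonneg)
  ultimately have "R (Suc j) = R j / (1 + h * d / e)"
    by (simp add: eq_divide_eq)
  then show ?thesis
    by (simp add: h_def e_def d_def)
qed

lemma divide_one_plus_nonneg: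
  fixes r a :: real
  assumes "r \<ge> 0" and "a \<ge> 0"
  shows "r / (1 + a) \<ge> 0" and "r / (1 + a) \<le> r"
proof -
  show "r / (1 + a) \<ge> 0"
    using assms by simp
  have "r * 1 \<le> r * (1 + a)"
    using assms by (intro mult_left_mono) simp_all
  then show "r / (1 + a) \<le> r"
    using assms by (simp add: divide_le_eq)
qed

theorem proposition3p16:
  fixes t E D R :: "nat \<Rightarrow> real" and C\<^sub>0 :: real
  assumes time_increments: "\<forall>j. t (Suc j) - t j > 0"
  shows "(\<forall>j. D (Suc j) \<ge> 0 \<longrightarrow> E (Suc j) + C\<^sub>0 > 0 \<longrightarrow> sav_update t E D C\<^sub>0 R j \<longrightarrow> R j \<ge> 0 \<longrightarrow>
            R (Suc j) = R j / (1 + (t (Suc j) - t j) * D (Suc j) / (E (Suc j) + C\<^sub>0)) \<and>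
            R j / (1 + (t (Suc j) - t j) * D (Suc j) / (E (Suc j) + C\<^sub>0)) \<le> R j)
       \<and> (R 0 = E 0 + C\<^sub>0 \<longrightarrow> (\<forall>j. E j + C\<^sub>0 > 0) \<longrightarrow> (\<forall>j. D (Suc j) \<ge> 0) \<longrightarrow>
            (\<forall>j. sav_update t E D C\<^sub>0 R j) \<longrightarrow> decseq R)"
proof -
  let ?a = "\<lambda>j. (t (Suc j) - t j) * D (Suc j) / (E (Suc j) + C\<^sub>0)"
  have a_nonneg: "?a j \<ge> 0" if "D (Suc j) \<ge> 0" "E (Suc j) + C\<^sub>0 > 0" for j
    using time_increments that by (simp add: less_imp_le)
  have solved: "R (Suc j) = R j / (1 + ?a j)"
    if "D (Suc j) \<ge> 0" "E (Suc j) + C\<^sub>0 > 0" "sav_update t E D C\<^sub>0 R j" for j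
    using time_increments that by (intro sav_update_solved) simp_all
  have "decseq R"
    if R0: "R 0 = E 0 + C\<^sub>0" and E: "\<forall>j. E j + C\<^sub>0 > 0" and D: "\<forall>j. D (Suc j) \<ge> 0"
      and upd: "\<forall>j. sav_update t E D C\<^sub>0 R j"
  proof -
    have step: "R (Suc j) = R j / (1 + ?a j)" and a: "?a j \<ge> 0" for j
      using solved a_nonneg E D upd by blast+
    \<comment> \<open>The one-step bound holds only for a nonnegative current value, so the sign is
      propagated first.\<close>
    have nonneg: "R j \<ge> 0" for j
    proof (induction j)
      case 0
      show ?case using R0 E by (simp add: less_imp_le)
    next
      case (Suc j)
      show ?case
        unfolding step[of j] by (rule divide_one_plus_nonneg(1)[OF Suc.IH a])
    qed
    show "decseq R"
    proof (rule decseq_SucI)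
      fix j
      show "R (Suc j) \<le> R j"
        unfolding step[of j] by (rule divide_one_plus_nonneg(2)[OF nonneg a])
    qed
  qed
  then show ?thesis
    using solved divide_one_plus_nonneg(2) a_nonneg by blast
qed

end
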